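(* Let $b\ge 2$ be an integer, let $T=(t_1,\ldots,t_b)$ be a $b$-tuple of positive integers, and let $w_T(n|z_1,\ldots,z_b)$ be the base $b$ Stern polynomials. For an integer $d\ge 0$ define the $2\times 2$ matrices $$\mathbf{A}_0(d)=\begin{pmatrix} z_{b-1}^{t_{b-1}^d} & 0\\ z_b^{t_b^d} & 1\end{pmatrix},\quad \mathbf{A}_1(d)=\begin{pmatrix} z_b^{t_b^d} & 1\\ 0 & z_1^{t_1^d}\end{pmatrix},\quad \mathbf{A}_i(d)=\begin{pmatrix} 0 & z_{i-1}^{t_{i-1}^d}\\ 0 & z_i^{t_i^d}\end{pmatrix}\ \ (2\le i\le b-1).$$ Let $n\ge 0$ be an integer with base $b$ expansion $i_s\cdots i_0$, i.e. $n=\sum_{k=0}^s i_k b^k$ with digits $0\le i_k\le b-1$. Then $$w_T(n|z_1,\ldots,z_b)=\begin{pmatrix}1 & 0\end{pmatrix}\mathbf{A}_{i_0}(0)\,\mathbf{A}_{i_1}(1)\cdots\mathbf{A}_{i_s}(s)\begin{pmatrix}0\\1\end{pmatrix}.$$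
   Context: Fix an integer $b\ge 2$ and a tuple $T=(t_1,\ldots,t_b)$ of positive integers. The base $b$ Stern polynomials $w_T(n|z_1,\ldots,z_b)\in\mathbb{Z}[z_1,\ldots,z_b]$ are defined by $w_T(0|z_1,\ldots,z_b)=0$, $w_T(1|z_1,\ldots,z_b)=1$, and for $n\ge 1$ by $$w_T(b(n-1)+j+1|z_1,\ldots,z_b)=z_j\,w_T(n|z_1^{t_1},\ldots,z_b^{t_b})\quad(1\le j\le b-1),$$ $$w_T(bn+1|z_1,\ldots,z_b)=z_b\,w_T(n|z_1^{t_1},\ldots,z_b^{t_b})+w_T(n+1|z_1^{t_1},\ldots,z_b^{t_b}).$$ Here $z_j^{t_j^d}$ means $z_j$ raised to the power $(t_j)^d$, with $(t_j)^0=1$. *)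

theory Defs
  imports "HOL-Analysis.Cartesian_Space" "HOL-Library.Poly_Mapping"
begin

text \<open>
  Integer polynomials in variables indexed by natural numbers, as finitely supported functions
  from exponent vectors to coefficients. \<open>\<int>[z\<^sub>1, \<dots>, z\<^sub>b]\<close> is the subring of those
  polynomials that involve only variables with index in \<open>{1..b}\<close>.
\<close>

type_synonym mpoly_int = "(nat \<Rightarrow>\<^sub>0 nat) \<Rightarrow>\<^sub>0 int"

definition Var :: "nat \<Rightarrow> mpoly_int" where
  "Var j = Poly_Mapping.single (Poly_Mapping.single j 1) 1"

definition mpoly_vars :: "mpoly_int \<Rightarrow> nat set" where
  "mpoly_vars p = (\<Union>m\<in>Poly_Mapping.keys p. Poly_Mapping.keys m)"

text \<open>Simultaneous substitution of the polynomial \<open>f j\<close> for the \<open>j\<close>-th variable.\<close>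

definition mpoly_subst :: "(nat \<Rightarrow> mpoly_int) \<Rightarrow> mpoly_int \<Rightarrow> mpoly_int" where
  "mpoly_subst f p =
     (\<Sum>m\<in>Poly_Mapping.keys p. of_int (Poly_Mapping.lookup p m) * (\<Prod>j\<in>Poly_Mapping.keys m. f j ^ Poly_Mapping.lookup m j))"

abbreviation pow_subst :: "(nat \<Rightarrow> nat) \<Rightarrow> mpoly_int \<Rightarrow> mpoly_int" where
  "pow_subst t \<equiv> mpoly_subst (\<lambda>j. Var j ^ t j)"

text \<open>
  Every \<open>n \<ge> 2\<close> is uniquely \<open>b * m + j + 1\<close> with \<open>1 \<le> j \<le> b\<close>, where \<open>m\<close> and \<open>j - 1\<close> are
  quotient and remainder of \<open>n - 2\<close> by \<open>b\<close>; the two branches below are the two recurrences,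
  stated in their usual form in \<open>stern_rec_lt\<close> and \<open>stern_rec_eq\<close>. The value for
  \<open>b < 2\<close> is a dummy that makes the recursion terminate. Only \<open>t 1, \<dots>, t b\<close> are relevant.
\<close>

function stern :: "nat \<Rightarrow> (nat \<Rightarrow> nat) \<Rightarrow> nat \<Rightarrow> mpoly_int" where
  "stern b t n =
     (if b < 2 \<or> n = 0 then 0
      else if n = 1 then 1
      else let m = (n - 2) div b; j = (n - 2) mod b + 1 in
        if j < b then Var j * pow_subst t (stern b t (m + 1))
        else Var b * pow_subst t (stern b t (m + 1)) + pow_subst t (stern b t (m + 2)))"
  by auto

lemma stern_arg_less:
  fixes b n :: nat
  assumes "b \<ge> 2" "n \<ge> 2"
  shows "(n - 2) div b + 1 < n"
proof -
  have "(n - 2) div b \<le> n - 2" by simp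
  then show ?thesis using assms by linarith
qed

lemma stern_arg_less':
  fixes b n :: nat
  assumes "b \<ge> 2" "n \<ge> 2" "\<not> (n - 2) mod b + 1 < b"
  shows "(n - 2) div b + 2 < n"
proof -
  have "(n - 2) mod b < b" using assms by simp
  then have "(n - 2) mod b \<ge> 1" using assms by linarith
  moreover have "(n - 2) div b * 2 \<le> (n - 2) div b * b" using assms by simp
  moreover have "(n - 2) div b * b + (n - 2) mod b = n - 2" by simp
  ultimately show ?thesis using assms by linarith
qed

termination
  by (relation "measure (\<lambda>(b, t, n). n)") (use stern_arg_less stern_arg_less' in auto)

declare stern.simps [simp del]

lemma stern_0: "stern b t 0 = 0"
  by (simp add: stern.simps)

lemma stern_1: "b \<ge> 2 \<Longrightarrow> stern b t 1 = 1"
  by (simp add: stern.simps)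

lemma stern_rec_lt:
  assumes "b \<ge> 2" "n \<ge> 1" "1 \<le> j" "j \<le> b - 1"
  shows "stern b t (b * (n - 1) + j + 1) = Var j * pow_subst t (stern b t n)"
proof -
  obtain i where i: "j = Suc i" using assms by (cases j) auto
  then have "i < b" using assms by linarith
  moreover have "b * (n - 1) + j + 1 - 2 = i + b * (n - 1)" using i by simp
  moreover have "(i + b * (n - 1)) div b = n - 1" "(i + b * (n - 1)) mod b = i"
    using \<open>i < b\<close> by simp_all
  ultimately show ?thesis
    using assms i by (subst stern.simps) (auto simp: Let_def)
qed

lemma stern_rec_eq:
  assumes "b \<ge> 2" "n \<ge> 1"
  shows "stern b t (b * n + 1) =
    Var b * pow_subst t (stern b t n) + pow_subst t (stern b t (n + 1))"
proof -
  obtain k where k: "n = Suc k" using assms by (cases n) auto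
  have "b * n + 1 - 2 = (b - 1) + b * k" using assms k by simp
  moreover have "((b - 1) + b * k) div b = k" "((b - 1) + b * k) mod b = b - 1"
    using assms by (simp_all del: One_nat_def add_diff_assoc2 Nat.add_diff_assoc2 diff_add_assoc2)
  ultimately show ?thesis
    using assms k by (subst stern.simps) (auto simp: Let_def)
qed

lemma mpoly_vars_add: "mpoly_vars (p + q) \<subseteq> mpoly_vars p \<union> mpoly_vars q"
  unfolding mpoly_vars_def using keys_add[of p q] by blast

lemma mpoly_vars_mult: "mpoly_vars (p * q) \<subseteq> mpoly_vars p \<union> mpoly_vars q"
proof
  fix x assume "x \<in> mpoly_vars (p * q)"
  then obtain a c where "a \<in> Poly_Mapping.keys p" "c \<in> Poly_Mapping.keys q"
      "x \<in> Poly_Mapping.keys (a + c)"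
    unfolding mpoly_vars_def using keys_mult[of p q] by blast
  then show "x \<in> mpoly_vars p \<union> mpoly_vars q"
    unfolding mpoly_vars_def using keys_add[of a c] by blast
qed

lemma mpoly_vars_0: "mpoly_vars 0 = {}"
  by (simp add: mpoly_vars_def)

lemma mpoly_vars_1: "mpoly_vars 1 = {}"
  by (simp add: mpoly_vars_def)

lemma mpoly_vars_of_int: "mpoly_vars (of_int c) = {}"
  by (simp add: mpoly_vars_def flip: single_of_int)

lemma mpoly_vars_Var: "mpoly_vars (Var j) = {j}"
  by (simp add: mpoly_vars_def Var_def)

lemma mpoly_vars_power: "mpoly_vars (p ^ k) \<subseteq> mpoly_vars p"
  by (induction k) (use mpoly_vars_1 mpoly_vars_mult in force)+

lemma mpoly_vars_prod:
  assumes "\<And>x. x \<in> A \<Longrightarrow> mpoly_vars (f x) \<subseteq> B"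
  shows "mpoly_vars (prod f A) \<subseteq> B"
  using assms
proof (induction A rule: infinite_finite_induct)
  case (insert x F)
  then show ?case using mpoly_vars_mult[of "f x" "prod f F"] by auto
qed (auto simp: mpoly_vars_1)

lemma mpoly_vars_sum:
  assumes "\<And>x. x \<in> A \<Longrightarrow> mpoly_vars (f x) \<subseteq> B"
  shows "mpoly_vars (sum f A) \<subseteq> B"
  using assms
proof (induction A rule: infinite_finite_induct)
  case (insert x F)
  then show ?case using mpoly_vars_add[of "f x" "sum f F"] by auto
qed (auto simp: mpoly_vars_0)

lemma mpoly_vars_pow_subst:
  assumes "mpoly_vars p \<subseteq> B"
  shows "mpoly_vars (pow_subst t p) \<subseteq> B"
  unfolding mpoly_subst_def
proof (rule mpoly_vars_sum)
  fix m assume m: "m \<in> Poly_Mapping.keys p"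
  have "mpoly_vars (\<Prod>j\<in>Poly_Mapping.keys m. (Var j ^ t j) ^ Poly_Mapping.lookup m j) \<subseteq> B"
  proof (rule mpoly_vars_prod)
    fix j assume "j \<in> Poly_Mapping.keys m"
    then have "j \<in> B" using m assms unfolding mpoly_vars_def by blast
    then show "mpoly_vars ((Var j ^ t j) ^ Poly_Mapping.lookup m j) \<subseteq> B"
      using mpoly_vars_power[of "Var j ^ t j"] mpoly_vars_power[of "Var j"] mpoly_vars_Var
      by fastforce
  qed
  then show "mpoly_vars (of_int (Poly_Mapping.lookup p m) *
      (\<Prod>j\<in>Poly_Mapping.keys m. (Var j ^ t j) ^ Poly_Mapping.lookup m j)) \<subseteq> B"
    using mpoly_vars_mult mpoly_vars_of_int by fastforce
qed

lemma mpoly_vars_stern: "mpoly_vars (stern b t n) \<subseteq> {1..b}"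
proof (induction n rule: less_induct)
  case (less n)
  show ?case
  proof (cases "b < 2 \<or> n < 2")
    case True
    then show ?thesis by (subst stern.simps) (auto simp: mpoly_vars_0 mpoly_vars_1)
  next
    case False
    define m where "m = (n - 2) div b"
    define j where "j = (n - 2) mod b + 1"
    have j: "j \<in> {1..b}" using False mod_less_divisor[of b "n - 2"] unfolding j_def
      by (simp add: Suc_le_eq)
    have 1: "mpoly_vars (pow_subst t (stern b t (m + 1))) \<subseteq> {1..b}"
      by (intro mpoly_vars_pow_subst less.IH)
        (use False stern_arg_less[of b n] in \<open>simp add: m_def\<close>)
    have 2: "mpoly_vars (Var i * pow_subst t (stern b t (m + 1))) \<subseteq> {1..b}"
      if "i \<in> {1..b}" for i
      using 1 that mpoly_vars_mult[of "Var i" "pow_subst t (stern b t (m + 1))"]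
      by (auto simp: mpoly_vars_Var)
    show ?thesis
    proof (cases "j < b")
      case True
      then have "stern b t n = Var j * pow_subst t (stern b t (m + 1))"
        using False by (subst stern.simps) (simp add: m_def j_def Let_def)
      then show ?thesis using 2[OF j] by simp
    next
      case nj: False
      then have "stern b t n =
          Var b * pow_subst t (stern b t (m + 1)) + pow_subst t (stern b t (m + 2))"
        using False by (subst stern.simps) (simp add: m_def j_def Let_def)
      moreover have "mpoly_vars (pow_subst t (stern b t (m + 2))) \<subseteq> {1..b}"
        by (intro mpoly_vars_pow_subst less.IH)
          (use False nj stern_arg_less'[of b n] in \<open>simp add: m_def j_def\<close>)
      moreover have "mpoly_vars (Var b * pow_subst t (stern b t (m + 1))) \<subseteq> {1..b}"
        using 2[of b] False by simp
      ultimately show ?thesis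
        by (simp only:) (rule subset_trans[OF mpoly_vars_add Un_least])
    qed
  qed
qed

definition stern_matrix :: "nat \<Rightarrow> (nat \<Rightarrow> nat) \<Rightarrow> nat \<Rightarrow> nat \<Rightarrow> mpoly_int^2^2" where
  "stern_matrix b t i d =
     (let z = (\<lambda>j. Var j ^ (t j ^ d)) in
      if i = 0 then vector [vector [z (b - 1), 0], vector [z b, 1]]
      else if i = 1 then vector [vector [z b, 1], vector [0, z 1]]
      else vector [vector [0, z (i - 1)], vector [0, z i]])"

text \<open>\<open>matrix_prod M n\<close> is \<open>M 0 ** M 1 ** \<dots> ** M (n - 1)\<close>, in this order.\<close>

primrec matrix_prod :: "(nat \<Rightarrow> mpoly_int^2^2) \<Rightarrow> nat \<Rightarrow> mpoly_int^2^2" where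
  "matrix_prod M 0 = mat 1"
| "matrix_prod M (Suc n) = matrix_prod M n ** M n"

end

theory Submission imports Defs begin

text \<open>
  Write \<open>\<phi>\<close> for the substitution \<open>z\<^sub>j \<mapsto> z\<^sub>j ^ t\<^sub>j\<close>. Two consecutive Stern polynomials with indices
  \<open>b * m + i\<close> and \<open>b * m + i + 1\<close> are linear in the pair with indices \<open>m\<close> and \<open>m + 1\<close>, twisted by
  \<open>\<phi>\<close>, and the matrix of this linear dependence is \<open>\<^bold>A\<^sub>i(0)\<close>. Iterating over the digits
  of \<open>n\<close>, from the lowest one upwards, peels off one matrix per digit until only the pair with
  indices \<open>0\<close> and \<open>1\<close> is left, which is the column \<open>(0, 1)\<close>.

  Each step adds one application of \<open>\<phi>\<close> to the remaining pair, so the matrix that the step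
  with number \<open>d\<close> contributes is the image of \<open>\<^bold>A\<^sub>i(0)\<close> under the \<open>d\<close>-fold iterate of \<open>\<phi>\<close>. The iterate
  is a ring homomorphism with \<open>z\<^sub>j \<mapsto> z\<^sub>j ^ (t\<^sub>j ^ d)\<close>, whence this image is \<open>\<^bold>A\<^sub>i(d)\<close>: that is
  \<open>stern_matrix_step\<close>. The induction over the number of digits in \<open>stern_pair_eq_matrix_prod\<close>
  keeps \<open>d\<close> as a parameter, because removing the lowest digit raises it by one.
\<close>

section \<open>Substitution is a ring homomorphism\<close>

definition monom_eval :: "(nat \<Rightarrow> mpoly_int) \<Rightarrow> (nat \<Rightarrow>\<^sub>0 nat) \<Rightarrow> mpoly_int" where
  "monom_eval f m = (\<Prod>j\<in>Poly_Mapping.keys m. f j ^ Poly_Mapping.lookup m j)"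

text \<open>
  The defining product runs over the keys of its own monomial. To compare different monomials,
  the index sets are enlarged to a common one; the additional factors have exponent \<open>0\<close>.
\<close>

lemma monom_eval_superset:
  assumes "finite S" "Poly_Mapping.keys m \<subseteq> S"
  shows "monom_eval f m = (\<Prod>j\<in>S. f j ^ Poly_Mapping.lookup m j)"
  unfolding monom_eval_def
  by (rule prod.mono_neutral_left) (use assms in \<open>auto simp: in_keys_iff\<close>)

lemma monom_eval_add: "monom_eval f (m + m') = monom_eval f m * monom_eval f m'"
proof -
  let ?S = "Poly_Mapping.keys m \<union> Poly_Mapping.keys m'"
  have "monom_eval f (m + m') = (\<Prod>j\<in>?S. f j ^ Poly_Mapping.lookup (m + m') j)"
    by (rule monom_eval_superset) (use keys_add[of m m'] in auto)
  also have "\<dots> = (\<Prod>j\<in>?S. f j ^ Poly_Mapping.lookup m j) *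
      (\<Prod>j\<in>?S. f j ^ Poly_Mapping.lookup m' j)"
    by (simp add: lookup_add power_add prod.distrib)
  also have "\<dots> = monom_eval f m * monom_eval f m'"
    by (simp add: monom_eval_superset[of ?S])
  finally show ?thesis .
qed

lemma mpoly_subst_superset:
  assumes "finite S" "Poly_Mapping.keys p \<subseteq> S"
  shows "mpoly_subst f p = (\<Sum>m\<in>S. of_int (Poly_Mapping.lookup p m) * monom_eval f m)"
  unfolding mpoly_subst_def monom_eval_def
  by (rule sum.mono_neutral_left) (use assms in \<open>auto simp: in_keys_iff\<close>)

lemma mpoly_subst_0: "mpoly_subst f 0 = 0"
  by (simp add: mpoly_subst_def)

lemma mpoly_subst_single: "mpoly_subst f (Poly_Mapping.single m c) = of_int c * monom_eval f m"
  by (simp add: mpoly_subst_superset[of "{m}"])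

lemma mpoly_subst_1: "mpoly_subst f 1 = 1"
  using mpoly_subst_single[of f 0 1] by (simp add: monom_eval_def)

lemma mpoly_subst_Var: "mpoly_subst f (Var j) = f j"
  by (simp add: Var_def mpoly_subst_single monom_eval_def)

lemma mpoly_subst_add: "mpoly_subst f (p + q) = mpoly_subst f p + mpoly_subst f q"
proof -
  let ?S = "Poly_Mapping.keys p \<union> Poly_Mapping.keys q"
  have "mpoly_subst f (p + q) =
      (\<Sum>m\<in>?S. of_int (Poly_Mapping.lookup (p + q) m) * monom_eval f m)"
    by (rule mpoly_subst_superset) (use keys_add[of p q] in auto)
  also have "\<dots> = mpoly_subst f p + mpoly_subst f q"
    by (simp add: mpoly_subst_superset[of ?S] lookup_add distrib_right sum.distrib)
  finally show ?thesis .
qed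

lemma mpoly_int_induct [case_names zero single_add]:
  fixes p :: mpoly_int
  assumes "P 0"
    and "\<And>m c p. P p \<Longrightarrow> P (Poly_Mapping.single m c + p)"
  shows "P p"
proof (induction p rule: update_induct)
  case const
  show ?case by (fact assms(1))
next
  case (update p m c)
  have "Poly_Mapping.update m c p = Poly_Mapping.single m c + p"
    by (rule poly_mapping_eqI)
      (use update in \<open>auto simp: lookup_update lookup_add lookup_single when_def in_keys_iff\<close>)
  then show ?case using assms(2) update by simp
qed

text \<open>
  By bilinearity it suffices to compare both sides on two monomials, where the claim is that
  \<open>monom_eval\<close> turns addition of exponent vectors into multiplication.
\<close>

lemma mpoly_subst_mult: "mpoly_subst f (p * q) = mpoly_subst f p * mpoly_subst f q"
proof (induction p rule: mpoly_int_induct)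
  case zero
  show ?case by (simp add: mpoly_subst_0)
next
  case (single_add m c p)
  have "mpoly_subst f (Poly_Mapping.single m c * q) =
      mpoly_subst f (Poly_Mapping.single m c) * mpoly_subst f q"
  proof (induction q rule: mpoly_int_induct)
    case zero
    show ?case by (simp add: mpoly_subst_0)
  next
    case (single_add m' c' q)
    then show ?case
      by (simp add: distrib_left mpoly_subst_add mult_single mpoly_subst_single monom_eval_add
          algebra_simps)
  qed
  then show ?case using single_add by (simp add: distrib_right mpoly_subst_add)
qed

lemma mpoly_subst_power: "mpoly_subst f (p ^ k) = mpoly_subst f p ^ k"
  by (induction k) (simp_all add: mpoly_subst_1 mpoly_subst_mult)

section \<open>Iterated power substitutions\<close>

lemma pow_subst_iter_0: "(pow_subst t ^^ d) 0 = 0"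
  by (induction d) (simp_all add: mpoly_subst_0)

lemma pow_subst_iter_1: "(pow_subst t ^^ d) 1 = 1"
  by (induction d) (simp_all add: mpoly_subst_1)

lemma pow_subst_iter_add:
  "(pow_subst t ^^ d) (p + q) = (pow_subst t ^^ d) p + (pow_subst t ^^ d) q"
  by (induction d) (simp_all add: mpoly_subst_add)

lemma pow_subst_iter_mult:
  "(pow_subst t ^^ d) (p * q) = (pow_subst t ^^ d) p * (pow_subst t ^^ d) q"
  by (induction d) (simp_all add: mpoly_subst_mult)

lemma pow_subst_iter_Var: "(pow_subst t ^^ d) (Var j) = Var j ^ (t j ^ d)"
  by (induction d) (simp_all add: mpoly_subst_power mpoly_subst_Var flip: power_mult)

lemmas pow_subst_iter_simps = pow_subst_iter_0 pow_subst_iter_1 pow_subst_iter_add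
  pow_subst_iter_mult pow_subst_iter_Var

section \<open>One digit\<close>

text \<open>
  In terms of the lowest digit, the recurrences become uniform: they then hold for \<open>m = 0\<close> too,
  because \<open>\<phi>\<close> fixes the values \<open>0\<close> and \<open>1\<close> of the polynomials with indices \<open>0\<close> and \<open>1\<close>.
  Hence the digits can be peeled off all the way down to \<open>m = 0\<close>, and past it through leading
  zeros.
\<close>

lemma stern_digit_0:
  assumes "b \<ge> 2"
  shows "stern b t (b * m) = Var (b - 1) * pow_subst t (stern b t m)"
proof (cases m)
  case 0
  then show ?thesis by (simp add: stern_0 mpoly_subst_0)
next
  case (Suc k)
  have "b * m = b * (m - 1) + (b - 1) + 1" using assms Suc by simp
  then show ?thesis
    using stern_rec_lt[of b m "b - 1" t] assms Suc by (simp add: add.commute)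
qed

lemma stern_digit_1:
  assumes "b \<ge> 2"
  shows "stern b t (b * m + 1) =
    Var b * pow_subst t (stern b t m) + pow_subst t (stern b t (m + 1))"
proof (cases "m = 0")
  case True
  then show ?thesis
    using stern_1[OF assms, of t] by (simp add: stern_0 mpoly_subst_0 mpoly_subst_1)
next
  case False
  then show ?thesis using stern_rec_eq[of b m t] assms by simp
qed

lemma stern_digit_Suc:
  assumes "b \<ge> 2" "1 \<le> j" "j \<le> b - 1"
  shows "stern b t (b * m + Suc j) = Var j * pow_subst t (stern b t (m + 1))"
  using stern_rec_lt[of b "m + 1" j t] assms by simp

definition stern_pair :: "nat \<Rightarrow> (nat \<Rightarrow> nat) \<Rightarrow> nat \<Rightarrow> nat \<Rightarrow> mpoly_int^2" where
  "stern_pair b t d n =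
     vector [(pow_subst t ^^ d) (stern b t n), (pow_subst t ^^ d) (stern b t (n + 1))]"

lemma stern_pair_0: "b \<ge> 2 \<Longrightarrow> stern_pair b t d 0 = vector [0, 1]"
  using stern_1[of b t] by (simp add: stern_pair_def stern_0 pow_subst_iter_simps)

lemma matrix_2_2_mult_vector:
  fixes p q r s x y :: "'a::comm_ring_1"
  shows "(vector [vector [p, q], vector [r, s]] :: 'a^2^2) *v vector [x, y] =
    vector [p * x + q * y, r * x + s * y]"
  by (simp add: vec_eq_iff forall_2 matrix_vector_mult_def sum_2)

text \<open>
  Apply the \<open>d\<close>-fold iterate of \<open>\<phi>\<close> to the recurrence of the digit. It turns the coefficients
  \<open>z\<^sub>j\<close> into the entries of \<open>\<^bold>A\<^sub>i(d)\<close>, and together with the \<open>\<phi>\<close> inside the recurrence it becomes the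
  \<open>(d + 1)\<close>-fold iterate.
\<close>

lemma stern_matrix_step:
  assumes "b \<ge> 2" "i \<le> b - 1"
  shows "stern_matrix b t i d *v stern_pair b t (Suc d) m = stern_pair b t d (b * m + i)"
proof -
  consider (zero) "i = 0" | (one) "i = 1" | (ge_two) "i \<ge> 2" by linarith
  then show ?thesis
  proof cases
    case zero
    then show ?thesis
      using assms stern_digit_0[of b t m] stern_digit_1[of b t m]
      by (simp add: stern_pair_def stern_matrix_def Let_def matrix_2_2_mult_vector
          pow_subst_iter_simps funpow_swap1)
  next
    case one
    then show ?thesis
      using assms stern_digit_1[of b t m] stern_digit_Suc[of b 1 t m]
      by (simp add: stern_pair_def stern_matrix_def Let_def matrix_2_2_mult_vector
          pow_subst_iter_simps funpow_swap1)
  next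
    case ge_two
    then show ?thesis
      using assms stern_digit_Suc[of b "i - 1" t m] stern_digit_Suc[of b i t m]
      by (simp add: stern_pair_def stern_matrix_def Let_def matrix_2_2_mult_vector
          pow_subst_iter_simps funpow_swap1)
  qed
qed

section \<open>All digits\<close>

lemma matrix_prod_Suc_shift: "matrix_prod M (Suc k) = M 0 ** matrix_prod (\<lambda>j. M (Suc j)) k"
  by (induction k) (simp_all add: matrix_mul_assoc)

lemma stern_pair_eq_matrix_prod:
  assumes "b \<ge> 2" "\<And>k. k < l \<Longrightarrow> i k \<le> b - 1"
  shows "matrix_prod (\<lambda>k. stern_matrix b t (i k) (d + k)) l *v vector [0, 1] =
    stern_pair b t d (\<Sum>k<l. i k * b ^ k)"
  using assms(2)
proof (induction l arbitrary: i d)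
  case 0
  then show ?case using assms(1) by (simp add: stern_pair_0)
next
  case (Suc l)
  let ?m = "\<Sum>k<l. i (Suc k) * b ^ k"
  have IH: "matrix_prod (\<lambda>k. stern_matrix b t (i (Suc k)) (Suc d + k)) l *v vector [0, 1] =
      stern_pair b t (Suc d) ?m"
    using Suc.IH[of "\<lambda>k. i (Suc k)" "Suc d"] Suc.prems by simp
  have "matrix_prod (\<lambda>k. stern_matrix b t (i k) (d + k)) (Suc l) *v vector [0, 1] =
      stern_matrix b t (i 0) d *v stern_pair b t (Suc d) ?m"
    by (simp add: matrix_prod_Suc_shift IH[symmetric] del: matrix_prod.simps
        flip: matrix_vector_mul_assoc)
  also have "\<dots> = stern_pair b t d (b * ?m + i 0)"
    using assms(1) Suc.prems by (intro stern_matrix_step) auto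
  also have "b * ?m + i 0 = (\<Sum>k<Suc l. i k * b ^ k)"
    by (simp add: sum.lessThan_Suc_shift sum_distrib_left mult_ac del: sum.lessThan_Suc)
  finally show ?case .
qed

lemma row_matrix_column_entry:
  fixes A :: "'a::comm_ring_1^2^2"
  shows "((vector [vector [1, 0]] :: 'a^2^1) ** A ** (vector [vector [0], vector [1]] :: 'a^1^2)) $ 1 $ 1
    = (A *v vector [0, 1]) $ 1"
  by (simp add: matrix_matrix_mult_def matrix_vector_mult_def sum_2 vector_def)

theorem theorem6:
  fixes b n s :: nat and t i :: "nat \<Rightarrow> nat"
  assumes "b \<ge> 2"
    and "\<And>j. 1 \<le> j \<Longrightarrow> j \<le> b \<Longrightarrow> t j > 0"
    and "\<And>k. k \<le> s \<Longrightarrow> i k \<le> b - 1"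
    and "n = (\<Sum>k=0..s. i k * b ^ k)"
  shows "stern b t n =
    ((vector [vector [1, 0]] :: mpoly_int^2^1)
      ** matrix_prod (\<lambda>k. stern_matrix b t (i k) k) (s + 1)
      ** (vector [vector [0], vector [1]] :: mpoly_int^1^2)) $ 1 $ 1"
proof -
  have n: "n = (\<Sum>k<s + 1. i k * b ^ k)"
    using assms(4) by (simp add: atLeast0AtMost lessThan_Suc_atMost)
  have "matrix_prod (\<lambda>k. stern_matrix b t (i k) k) (s + 1) *v vector [0, 1] = stern_pair b t 0 n"
    using stern_pair_eq_matrix_prod[of b "s + 1" i t 0] assms(1,3) n by simp
  then show ?thesis
    unfolding row_matrix_column_entry by (simp add: stern_pair_def)
qed

end
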